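(* Let $G$ be the simplicial complex (banana graph) with vertices $v_1,\dots,v_5$, whose $2$-simplices are $$\{v_3,v_4,v_5\},\ \{v_1,v_3,v_4\},\ \{v_1,v_4,v_5\},\ \{v_1,v_3,v_5\},\ \{v_2,v_3,v_4\},\ \{v_2,v_4,v_5\},\ \{v_2,v_3,v_5\},$$ and whose edges are the nine $2$-element subsets of these (all pairs of vertices except $\{v_1,v_2\}$). Then edge area transferal holds for $G$.
   Context: Let $\mathcal E_1$ be the set of edges and $\mathcal E_2$ the set of $2$-simplices (triangles) of $G$. Let $\alpha(x,y,z)=-\frac{x^2}{2}-\frac{y^2}{2}-\frac{z^2}{2}+xy+xz+yz$. The length-to-area map of $G$ is the polynomial map $\Phi:\mathbb R^{\mathcal E_1}\to\mathbb R^{\mathcal E_2}$ whose coordinate at the triangle $T=\{u,v,w\}\in\mathcal E_2$ is $\Phi(t)_T=\alpha(t_{\{u,v\}},t_{\{u,w\}},t_{\{v,w\}})$. Edge area transferal holds for $G$ if there is some input $t\in\mathbb R^{\mathcal E_1}$ at which the derivative matrix $D\Phi(t)$ has full row rank $|\mathcal E_2|$. *)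

theory Defs
  imports "HOL-Analysis.Analysis"
begin

text \<open>A simplicial complex is represented by its set of (nonempty) simplices.\<close>

definition edges :: "'v set set \<Rightarrow> 'v set set" where
  "edges K = {s \<in> K. card s = 2}"

definition triangles :: "'v set set \<Rightarrow> 'v set set" where
  "triangles K = {s \<in> K. card s = 3}"

definition alpha :: "real \<Rightarrow> real \<Rightarrow> real \<Rightarrow> real" where
  "alpha x y z = - (x\<^sup>2 / 2) - y\<^sup>2 / 2 - z\<^sup>2 / 2 + x * y + x * z + y * z"

text \<open>
  The spaces of real functions on the edges and on the triangles are \<open>real ^ 'e\<close> and
  \<open>real ^ 'f\<close>, where \<open>edge :: 'e \<Rightarrow> 'v set\<close> and \<open>tri :: 'f \<Rightarrow> 'v set\<close> are injective
  enumerations of the edges and the triangles by finite types; thus the coordinate of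
  \<open>t\<close> at the edge \<open>s\<close> is \<open>t $ inv edge s\<close>.
  Since \<open>alpha\<close> is symmetric, the description below does not depend on the ordering of
  the three vertices (see \<open>length_to_area_nth\<close>).
\<close>

definition length_to_area ::
    "('e::finite \<Rightarrow> 'v set) \<Rightarrow> ('f::finite \<Rightarrow> 'v set) \<Rightarrow> real ^ 'e \<Rightarrow> real ^ 'f" where
  "length_to_area edge tri t =
     (\<chi> T. THE a. \<exists>u v w. tri T = {u, v, w} \<and> distinct [u, v, w] \<and>
        a = alpha (t $ inv edge {u, v}) (t $ inv edge {u, w}) (t $ inv edge {v, w}))"

lemma length_to_area_nth:
  assumes "tri T = {u, v, w}" and "distinct [u, v, w]"
  shows "length_to_area edge tri t $ T =
    alpha (t $ inv edge {u, v}) (t $ inv edge {u, w}) (t $ inv edge {v, w})"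
proof -
  let ?F = "\<lambda>u v w. alpha (t $ inv edge {u, v}) (t $ inv edge {u, w}) (t $ inv edge {v, w})"
  have swap: "{v, u} = {u, v}" "{w, u} = {u, w}" "{w, v} = {v, w}"
    by auto
  have sym: "?F u' v' w' = ?F u v w"
    if "{u, v, w} = {u', v', w'}" and "distinct [u', v', w']" for u' v' w'
  proof -
    have "u' \<in> {u, v, w}" "v' \<in> {u, v, w}" "w' \<in> {u, v, w}"
      using that(1) by simp_all
    with that(2) have
      "(u' = u \<and> v' = v \<and> w' = w) \<or> (u' = u \<and> v' = w \<and> w' = v) \<or> (u' = v \<and> v' = u \<and> w' = w) \<or>
       (u' = v \<and> v' = w \<and> w' = u) \<or> (u' = w \<and> v' = u \<and> w' = v) \<or> (u' = w \<and> v' = v \<and> w' = u)"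
      by simp metis
    then show ?thesis
      by (elim disjE conjE) (simp_all add: alpha_def swap)
  qed
  show ?thesis
    unfolding length_to_area_def vec_lambda_beta
  proof (rule the_equality)
    show "\<exists>u' v' w'. tri T = {u', v', w'} \<and> distinct [u', v', w'] \<and> ?F u v w = ?F u' v' w'"
      using assms by blast
  next
    fix a
    assume "\<exists>u' v' w'. tri T = {u', v', w'} \<and> distinct [u', v', w'] \<and> a = ?F u' v' w'"
    then show "a = ?F u v w"
      using assms(1) sym by metis
  qed
qed

text \<open>The derivative matrix has its rows indexed by the triangles and its columns by the edges.
  The map is polynomial, so \<open>frechet_derivative\<close> is its actual derivative at every point.\<close>

definition edge_area_transferal ::
    "'v set set \<Rightarrow> ('e::finite \<Rightarrow> 'v set) \<Rightarrow> ('f::finite \<Rightarrow> 'v set) \<Rightarrow> bool" where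
  "edge_area_transferal K edge tri \<longleftrightarrow>
     bij_betw edge UNIV (edges K) \<and> bij_betw tri UNIV (triangles K) \<and>
     (\<exists>t. rank (matrix (frechet_derivative (length_to_area edge tri) (at t)))
            = card (triangles K))"

datatype vertex = v1 | v2 | v3 | v4 | v5

definition banana :: "vertex set set" where
  "banana = {s. s \<noteq> {} \<and> (\<exists>T \<in> {{v3, v4, v5}, {v1, v3, v4}, {v1, v4, v5}, {v1, v3, v5},
                                  {v2, v3, v4}, {v2, v4, v5}, {v2, v3, v5}}. s \<subseteq> T)}"

lemma triangles_banana:
  "triangles banana = {{v3, v4, v5}, {v1, v3, v4}, {v1, v4, v5}, {v1, v3, v5},
                       {v2, v3, v4}, {v2, v4, v5}, {v2, v3, v5}}" (is "_ = ?R")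
proof (intro equalityI subsetI)
  fix s assume "s \<in> triangles banana"
  then obtain T where T: "T \<in> ?R" "s \<subseteq> T" and s: "card s = 3"
    by (auto simp only: triangles_def banana_def mem_Collect_eq)
  moreover from T(1) have "finite T" "card T = 3" by auto
  ultimately have "s = T" by (metis card_subset_eq)
  with T show "s \<in> ?R" by simp
next
  fix s assume "s \<in> ?R"
  moreover from this have "card s = 3" "s \<noteq> {}" by auto
  ultimately show "s \<in> triangles banana"
    unfolding triangles_def banana_def by blast
qed

lemma edges_banana:
  "edges banana = {{v1, v3}, {v1, v4}, {v1, v5}, {v2, v3}, {v2, v4}, {v2, v5},
                   {v3, v4}, {v3, v5}, {v4, v5}}" (is "_ = ?R")
proof (intro equalityI subsetI)
  fix s assume "s \<in> edges banana"
  then have "card s = 2" and sub: "\<exists>T \<in> triangles banana. s \<subseteq> T"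
    unfolding triangles_banana by (simp_all only: edges_def banana_def mem_Collect_eq)
  then obtain a b where s: "s = {a, b}" "a \<noteq> b"
    by (meson card_2_iff)
  with sub show "s \<in> ?R"
    by (cases a; cases b) (simp_all add: triangles_banana doubleton_eq_iff)
next
  fix s assume R: "s \<in> ?R"
  then have "card s = 2" "s \<noteq> {}" by auto
  moreover from R have "s \<in> banana" by (auto simp: banana_def)
  ultimately show "s \<in> edges banana" by (simp add: edges_def)
qed

typedef banana_edge = "edges banana"
  by (auto simp: edges_banana)

typedef banana_triangle = "triangles banana"
  by (auto simp: triangles_banana)

instance banana_edge :: finite
proof
  have "finite (edges banana)" by (simp add: edges_banana)
  then show "finite (UNIV :: banana_edge set)"
    by (metis finite_imageI type_definition.univ type_definition_banana_edge)
qed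

instance banana_triangle :: finite
proof
  have "finite (triangles banana)" by (simp add: triangles_banana)
  then show "finite (UNIV :: banana_triangle set)"
    by (metis finite_imageI type_definition.univ type_definition_banana_triangle)
qed

end

theory Submission imports Defs begin

text \<open>
  At the input with all lengths equal to 1 every partial derivative of \<open>alpha\<close> is 1, so the
  derivative sends \<open>h\<close> to the function whose value at a triangle is the sum of \<open>h\<close> over its
  three edges. This is surjective for the banana graph: put the value prescribed at
  \<open>{v3, v4, v5}\<close> on the edge \<open>{v3, v4}\<close> and 0 on the other two edges of that triangle. For each of
  the apices \<open>v1\<close> and \<open>v2\<close> the three remaining equations then prescribe the pairwise sums of the
  three unknowns on the edges at that apex.
\<close>

lemma rank_matrix_eq_CARD_if_surj:
  fixes f :: "real ^ 'e::finite \<Rightarrow> real ^ 'f::finite"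
  assumes "linear f" and "surj f"
  shows "rank (matrix f) = CARD('f)"
  using assms by (simp add: rank_dim_range)

lemma has_derivative_alpha:
  "((\<lambda>t :: real ^ 'e::finite. alpha (t $ a) (t $ b) (t $ c))
     has_derivative (\<lambda>h. h $ a + h $ b + h $ c)) (at 1)"
proof -
  have nth: "((\<lambda>t. t $ i) has_derivative (\<lambda>h. h $ i)) (at (1 :: real ^ 'e))" for i
    by (intro bounded_linear_imp_has_derivative bounded_linear_vec_nth)
  show ?thesis
    unfolding alpha_def power2_eq_square
    by (rule has_derivative_eq_rhs, (rule nth derivative_intros | simp)+)
      (simp add: fun_eq_iff field_simps)
qed

text \<open>The double sum runs over ordered pairs of vertices and so meets each edge of a triangle
  twice, hence the division by 2. In this form no ordering of the vertices has to be chosen.\<close>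

lemma has_derivative_length_to_area:
  fixes edge :: "'e::finite \<Rightarrow> 'v set" and tri :: "'f::finite \<Rightarrow> 'v set"
  assumes "\<And>T. card (tri T) = 3"
  shows "(length_to_area edge tri has_derivative
           (\<lambda>h. \<chi> T. (\<Sum>u\<in>tri T. \<Sum>v\<in>tri T - {u}. h $ inv edge {u, v}) / 2)) (at 1)"
proof (subst has_derivative_componentwise_within, clarsimp simp: Basis_vec_def inner_axis)
  fix T
  obtain u v w where T: "tri T = {u, v, w}" "u \<noteq> v" "u \<noteq> w" "v \<noteq> w"
    using assms[of T] by (auto simp: card_3_iff)
  have swap: "{v, u} = {u, v}" "{w, u} = {u, w}" "{w, v} = {v, w}"
    by auto
  have "(\<Sum>x\<in>tri T. \<Sum>y\<in>tri T - {x}. h $ inv edge {x, y}) / 2 =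
      h $ inv edge {u, v} + h $ inv edge {u, w} + h $ inv edge {v, w}" for h :: "real ^ 'e"
    using T by (simp add: insert_Diff_if swap)
  moreover have "length_to_area edge tri t $ T =
      alpha (t $ inv edge {u, v}) (t $ inv edge {u, w}) (t $ inv edge {v, w})" for t
    using T by (intro length_to_area_nth) auto
  ultimately show "((\<lambda>t. length_to_area edge tri t $ T) has_derivative
      (\<lambda>h. (\<Sum>u\<in>tri T. \<Sum>v\<in>tri T - {u}. h $ inv edge {u, v}) / 2)) (at 1)"
    by (simp only: has_derivative_alpha)
qed

text \<open>Taking \<open>g\<close> and \<open>Y\<close> on sets of vertices, free of the index
  types, lets the linear system be checked triangle by triangle on explicit sets.\<close>

lemma triangle_sums_of_edges_surj:
  fixes Y :: "vertex set \<Rightarrow> real"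
  shows "\<exists>g. \<forall>s\<in>triangles banana. (\<Sum>u\<in>s. \<Sum>v\<in>s - {u}. g {u, v}) / 2 = Y s"
proof (intro exI ballI)
  define base where "base = Y {v3, v4, v5}"
  \<comment> \<open>This is the value on the edge {i, j}. Half the sum of the three prescribed
    pairwise sums is the sum of all three unknowns at \<open>i\<close>; subtracting the pairwise sum
    that omits \<open>j\<close> leaves the unknown at \<open>j\<close>. Only {i, v3, v4} needs the
    correction by \<open>base\<close>, the other two base edges being 0.\<close>
  define apex where "apex i j = (Y {i, v3, v4} - base + Y {i, v4, v5} + Y {i, v3, v5}) / 2
    - (if j = v3 then Y {i, v4, v5} else if j = v4 then Y {i, v3, v5} else Y {i, v3, v4} - base)"
    for i j
  define g where "g s = (if s = {v3, v4} then base else if s = {v3, v5} \<or> s = {v4, v5} then 0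
    else if v1 \<in> s then apex v1 (the_elem (s - {v1})) else apex v2 (the_elem (s - {v2})))" for s
  fix s assume "s \<in> triangles banana"
  then show "(\<Sum>u\<in>s. \<Sum>v\<in>s - {u}. g {u, v}) / 2 = Y s"
    unfolding triangles_banana
    by (elim insertE emptyE)
      (simp_all add: insert_Diff_if g_def apex_def base_def doubleton_eq_iff field_simps)
qed

theorem proposition3p18:
  shows "edge_area_transferal banana Rep_banana_edge Rep_banana_triangle"
proof -
  let ?E = "Rep_banana_edge" and ?T = "Rep_banana_triangle"
  let ?D = "\<lambda>h :: real ^ banana_edge.
    \<chi> T. (\<Sum>u\<in>?T T. \<Sum>v\<in>?T T - {u}. h $ inv ?E {u, v}) / 2"
  have E: "bij_betw ?E UNIV (edges banana)"
    by (simp add: bij_betw_def inj_on_def Rep_banana_edge_inject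
        type_definition.Rep_range[OF type_definition_banana_edge])
  have T: "bij_betw ?T UNIV (triangles banana)"
    by (simp add: bij_betw_def inj_on_def Rep_banana_triangle_inject
        type_definition.Rep_range[OF type_definition_banana_triangle])
  have "card (?T T) = 3" for T
    using Rep_banana_triangle[of T] by (simp add: triangles_def)
  then have D: "(length_to_area ?E ?T has_derivative ?D) (at 1)"
    by (rule has_derivative_length_to_area)
  have "y \<in> range ?D" for y
  proof -
    obtain g where g: "\<forall>s\<in>triangles banana.
        (\<Sum>u\<in>s. \<Sum>v\<in>s - {u}. g {u, v}) / 2 = y $ inv ?T s"
      using triangle_sums_of_edges_surj[of "\<lambda>s. y $ inv ?T s"] ..
    \<comment> \<open>Only on edges does \<open>inv ?E\<close> undo \<open>?E\<close>; this is what
      lets the vector with entries \<open>g (?E e)\<close> reproduce the values of \<open>g\<close>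
      in the sums.\<close>
    have "{u, v} \<in> edges banana" if "s \<in> triangles banana" "u \<in> s" "v \<in> s - {u}" for s u v
    proof -
      have "{u, v} \<subseteq> s" "{u, v} \<noteq> {}" "card {u, v} = 2"
        using that by auto
      with that(1) show ?thesis
        unfolding triangles_def edges_def banana_def mem_Collect_eq by (meson order_trans)
    qed
    then have "?E (inv ?E {u, v}) = {u, v}" if "u \<in> ?T T" "v \<in> ?T T - {u}" for T u v
      using that Rep_banana_triangle E by (metis bij_betw_inv_into_right)
    then have "?D (\<chi> e. g (?E e)) = (\<chi> T. (\<Sum>u\<in>?T T. \<Sum>v\<in>?T T - {u}. g {u, v}) / 2)"
      by (simp add: vec_eq_iff)
    also have "\<dots> = y"
      using T by (simp add: vec_eq_iff bspec[OF g] Rep_banana_triangle bij_betw_def)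
    finally show ?thesis
      by (rule range_eqI[OF sym])
  qed
  then have "surj ?D"
    by blast
  with has_derivative_linear[OF D] have "rank (matrix ?D) = CARD(banana_triangle)"
    by (rule rank_matrix_eq_CARD_if_surj)
  then have "rank (matrix (frechet_derivative (length_to_area ?E ?T) (at 1))) =
      card (triangles banana)"
    using bij_betw_same_card[OF T] frechet_derivative_at[OF D] by simp
  with E T show ?thesis
    unfolding edge_area_transferal_def by blast
qed

end
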